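(* There exists a universal constant $c\in(0,\infty)$ (not depending on $\mathcal F$ or $P$) such that, for all $\epsilon,\delta\in(0,1)$, all $\beta\in\left(0,\frac{1-\delta}{\delta}\right)$, and any sequence $\delta_m$ in $(0,1]$ with $\sum_{i=0}^{\lfloor\log_2(M(\epsilon,\delta/2))\rfloor}\delta_{2^i}\le\delta/2$, $$\max_{m\le M(\epsilon,1-\beta\delta)}\mathcal B_{\hat n}(m,(1+\beta)\delta)\le\Lambda(\epsilon,\delta)$$ and $$\Lambda(\epsilon,\delta)\le c\left(\max_{m\le M(\epsilon,\delta/2)}\mathcal B_{\hat n}(m,\delta_m)\ln\left(\frac{em}{\mathcal B_{\hat n}(m,\delta_m)}\right)+\ln\left(\frac{\log_2(2M(\epsilon,\delta/2))}{\delta}\right)\right)\log_2(2M(\epsilon,\delta/2)).$$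
   Context: Let $\mathcal X$ be an instance space and $\mathcal Y=\{-1,+1\}$. A classifier is a measurable function $h:\mathcal X\to\mathcal Y$. Fix a set $\mathcal F$ of classifiers and a probability measure $P$ on $\mathcal X\times\mathcal Y$; the error rate is $\mathrm{er}(h)=P((x,y):h(x)\ne y)$. Realizable case: there is a target function $f^*\in\mathcal F$ with $\mathbb P(Y=f^*(x)\mid X=x)=1$ for all $x\in\mathcal X$, where $(X,Y)\sim P$. For a set $\mathcal H$ of classifiers, $\mathrm{DIS}(\mathcal H)=\{x\in\mathcal X:\exists h,g\in\mathcal H,\ h(x)\ne g(x)\}$. Let $S_\infty=\{(x_1,y_1),(x_2,y_2),\ldots\}$ be i.i.d. with distribution $P$, $S_m=\{(x_1,y_1),\ldots,(x_m,y_m)\}$ ($S_0=\emptyset$), and suppose $y_i=f^*(x_i)$ for all $i$ (true with probability 1). For a sample $S$, the version space is $\mathrm{VS}_{\mathcal F,S}=\{h\in\mathcal F:\forall (x,y)\in S,\ h(x)=y\}$. For finite $S$, the version space compression set size $\hat n(S)=\hat n(\mathcal F,S)$ is the size of a smallest subset $C\subseteq S$ with $\mathrm{VS}_{\mathcal F,C}=\mathrm{VS}_{\mathcal F,S}$. For $m\in\mathbb N\cup\{0\}$, $\delta\in(0,1]$, $$\mathcal B_{\hat n}(m,\delta)=\min\{b\in\mathbb N\cup\{0\}:\mathbb P(\hat n(S_m)\le b)\ge 1-\delta\}.$$ Define $N(m;S_m)=\sum_{t=1}^m \mathbf 1[x_t\in\mathrm{DIS}(\mathrm{VS}_{\mathcal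 F,S_{t-1}})]$ (the number of labels requested by the CAL active learning algorithm among the first $m$ points). For $n\in\mathbb N$, $M(n;S_\infty)=\min\{m\in\mathbb N:N(m;S_m)=n\}$, or $M(n;S_\infty)=\infty$ if $\max_m N(m;S_m)<n$. For $\epsilon,\delta\in(0,1]$, $$\Lambda(\epsilon,\delta)=\min\Big\{n\in\mathbb N:\mathbb P\Big(\sup_{h\in\mathrm{VS}_{\mathcal F,S_{M(n;S_\infty)}}}\mathrm{er}(h)\le\epsilon\Big)\ge1-\delta\Big\}$$ (the label complexity of CAL), and $$M(\epsilon,\delta)=\min\Big\{m\in\mathbb N:\mathbb P\Big(\sup_{h\in\mathrm{VS}_{\mathcal F,S_m}}\mathrm{er}(h)\le\epsilon\Big)\ge1-\delta\Big\}$$ (the sample complexity of passive empirical risk minimization). The minimum of an empty set is $\infty$. Convention: $0\ln(1/0)=0\ln(\infty)=0$.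
   Formalization: The upper bound on Λ(ε,δ) is stated only when δ ≤ 1/2 or some h in F has er(h) > ε; otherwise Λ(ε,δ) = 1 and, e.g. for F = {f*} with δ near 1, the literal bound fails for every fixed c. The events whose probabilities are taken are assumed measurable. *)

theory Defs
  imports "HOL-Probability.Probability"
begin

abbreviation label_space :: "int measure" where
  "label_space \<equiv> count_space {-1, 1}"

abbreviation classifiers :: "'x measure \<Rightarrow> ('x \<Rightarrow> int) set" where
  "classifiers X \<equiv> X \<rightarrow>\<^sub>M label_space"

definition er :: "('x \<times> int) measure \<Rightarrow> ('x \<Rightarrow> int) \<Rightarrow> real" where
  "er P h = measure P {z \<in> space P. h (fst z) \<noteq> snd z}"

text \<open>The conditional probability of \<open>Y = f x\<close> given \<open>X = x\<close> is determined only up to null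
  sets of the marginal; that the constant \<open>1\<close> is a version of it says that \<open>Y = f X\<close> holds
  almost surely.\<close>

definition realizable :: "('x \<times> int) measure \<Rightarrow> ('x \<Rightarrow> int) \<Rightarrow> bool" where
  "realizable P f \<longleftrightarrow> (AE z in P. snd z = f (fst z))"

definition DIS :: "'x measure \<Rightarrow> ('x \<Rightarrow> int) set \<Rightarrow> 'x set" where
  "DIS X H = {x \<in> space X. \<exists>h\<in>H. \<exists>g\<in>H. h x \<noteq> g x}"

definition VS :: "('x \<Rightarrow> int) set \<Rightarrow> ('x \<times> int) set \<Rightarrow> ('x \<Rightarrow> int) set" where
  "VS F S = {h \<in> F. \<forall>(x, y)\<in>S. h x = y}"

text \<open>The canonical space of i.i.d. sequences with law \<open>P\<close>. Sequences are indexed from \<open>0\<close>, so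
  \<open>\<omega> i\<close> is the example number \<open>i + 1\<close>. In the realizable case all labels agree with the target
  function outside a null set.\<close>

definition seq_space :: "('x \<times> int) measure \<Rightarrow> (nat \<Rightarrow> 'x \<times> int) measure" where
  "seq_space P = PiM UNIV (\<lambda>_. P)"

text \<open>The length may be infinite, in which case the sample is the whole sequence.\<close>

definition sample :: "enat \<Rightarrow> (nat \<Rightarrow> 'x \<times> int) \<Rightarrow> ('x \<times> int) set" where
  "sample m \<omega> = \<omega> ` {i. enat i < m}"

text \<open>Only meaningful for finite \<open>S\<close>.\<close>

definition compression_size :: "('x \<Rightarrow> int) set \<Rightarrow> ('x \<times> int) set \<Rightarrow> nat" where
  "compression_size F S = (LEAST k. \<exists>C\<subseteq>S. card C = k \<and> VS F C = VS F S)"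

definition compression_event ::
  "('x \<Rightarrow> int) set \<Rightarrow> ('x \<times> int) measure \<Rightarrow> nat \<Rightarrow> nat \<Rightarrow> (nat \<Rightarrow> 'x \<times> int) set" where
  "compression_event F P m b = {\<omega> \<in> space (seq_space P). compression_size F (sample m \<omega>) \<le> b}"

text \<open>The set of admissible \<open>b\<close> is never empty, as it contains \<open>m\<close>.\<close>

definition compression_bound ::
  "('x \<Rightarrow> int) set \<Rightarrow> ('x \<times> int) measure \<Rightarrow> nat \<Rightarrow> real \<Rightarrow> nat" where
  "compression_bound F P m \<delta> = (LEAST b. measure (seq_space P) (compression_event F P m b) \<ge> 1 - \<delta>)"

definition num_labels ::
  "'x measure \<Rightarrow> ('x \<Rightarrow> int) set \<Rightarrow> nat \<Rightarrow> (nat \<Rightarrow> 'x \<times> int) \<Rightarrow> nat" where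
  "num_labels X F m \<omega> = (\<Sum>t<m. of_bool (fst (\<omega> t) \<in> DIS X (VS F (sample t \<omega>))))"

text \<open>In \<^typ>\<open>enat\<close>, the infimum of a nonempty set is its minimum, and that of the empty set is
  \<open>\<infinity>\<close>. Below, every minimum that may be \<open>\<infinity>\<close> is written in this way.\<close>

definition CAL_time ::
  "'x measure \<Rightarrow> ('x \<Rightarrow> int) set \<Rightarrow> nat \<Rightarrow> (nat \<Rightarrow> 'x \<times> int) \<Rightarrow> enat" where
  "CAL_time X F n \<omega> = Inf {enat m | m. m \<ge> 1 \<and> num_labels X F m \<omega> = n}"

text \<open>The supremum is taken in \<^typ>\<open>ereal\<close> because the version space may be empty on the null set
  of samples that are inconsistent with the target function.\<close>

definition sup_er :: "('x \<times> int) measure \<Rightarrow> ('x \<Rightarrow> int) set \<Rightarrow> ereal" where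
  "sup_er P H = (SUP h\<in>H. ereal (er P h))"

definition CAL_good_event ::
  "'x measure \<Rightarrow> ('x \<Rightarrow> int) set \<Rightarrow> ('x \<times> int) measure \<Rightarrow> real \<Rightarrow> nat \<Rightarrow> (nat \<Rightarrow> 'x \<times> int) set" where
  "CAL_good_event X F P \<epsilon> n =
    {\<omega> \<in> space (seq_space P). sup_er P (VS F (sample (CAL_time X F n \<omega>) \<omega>)) \<le> ereal \<epsilon>}"

definition ERM_good_event ::
  "('x \<Rightarrow> int) set \<Rightarrow> ('x \<times> int) measure \<Rightarrow> real \<Rightarrow> nat \<Rightarrow> (nat \<Rightarrow> 'x \<times> int) set" where
  "ERM_good_event F P \<epsilon> m =
    {\<omega> \<in> space (seq_space P). sup_er P (VS F (sample m \<omega>)) \<le> ereal \<epsilon>}"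

definition label_complexity ::
  "'x measure \<Rightarrow> ('x \<Rightarrow> int) set \<Rightarrow> ('x \<times> int) measure \<Rightarrow> real \<Rightarrow> real \<Rightarrow> enat" where
  "label_complexity X F P \<epsilon> \<delta> =
    Inf {enat n | n. n \<ge> 1 \<and> measure (seq_space P) (CAL_good_event X F P \<epsilon> n) \<ge> 1 - \<delta>}"

definition sample_complexity ::
  "('x \<Rightarrow> int) set \<Rightarrow> ('x \<times> int) measure \<Rightarrow> real \<Rightarrow> real \<Rightarrow> enat" where
  "sample_complexity F P \<epsilon> \<delta> =
    Inf {enat m | m. m \<ge> 1 \<and> measure (seq_space P) (ERM_good_event F P \<epsilon> m) \<ge> 1 - \<delta>}"

text \<open>The usual tacit assumption that all events under consideration are measurable. It cannot be
  omitted: \<^const>\<open>measure\<close> is \<open>0\<close> on non-measurable sets, and for an arbitrary set of classifiers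
  not even the region of disagreement need be measurable.\<close>

definition measurable_events ::
  "'x measure \<Rightarrow> ('x \<Rightarrow> int) set \<Rightarrow> ('x \<times> int) measure \<Rightarrow> real \<Rightarrow> bool" where
  "measurable_events X F P \<epsilon> \<longleftrightarrow>
    (\<forall>t. {\<omega> \<in> space (seq_space P). fst (\<omega> t) \<in> DIS X (VS F (sample t \<omega>))} \<in> sets (seq_space P)) \<and>
    (\<forall>m b. compression_event F P m b \<in> sets (seq_space P)) \<and>
    (\<forall>m. ERM_good_event F P \<epsilon> m \<in> sets (seq_space P)) \<and>
    (\<forall>n\<ge>1. CAL_good_event X F P \<epsilon> n \<in> sets (seq_space P))"

text \<open>The sum of \<open>d (2 ^ i)\<close> over \<open>0 \<le> i \<le> \<lfloor>log\<^sub>2 M\<rfloor>\<close>, an infinite series if \<open>M = \<infinity>\<close>.\<close>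

definition dyadic_sum :: "enat \<Rightarrow> (nat \<Rightarrow> real) \<Rightarrow> ennreal" where
  "dyadic_sum M d = (case M of
      enat k \<Rightarrow> (\<Sum>i=0..nat \<lfloor>log 2 (real k)\<rfloor>. ennreal (d (2 ^ i)))
    | \<infinity> \<Rightarrow> (\<Sum>i. ennreal (d (2 ^ i))))"

text \<open>The upper bound for \<open>M = \<infinity>\<close> is \<open>\<infinity>\<close>, since the logarithmic terms are. The convention
  \<open>0 ln (1/0) = 0\<close> holds automatically because \<open>0 * x = 0\<close> for every real \<open>x\<close>.

  The bound tends to \<open>0\<close> as \<open>\<delta> \<rightarrow> 1\<close> when the first summand vanishes and \<open>M = 1\<close>, for example
  for a singleton \<open>F\<close>, whereas the label complexity is always at least \<open>1\<close>. Hence it can only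
  hold with a universal \<open>c\<close> if \<open>\<delta>\<close> is bounded away from \<open>1\<close> or some classifier in \<open>F\<close> has error
  rate above \<open>\<epsilon>\<close>; otherwise the label complexity equals \<open>1\<close>.\<close>

definition CAL_upper_bound ::
  "real \<Rightarrow> ('x \<Rightarrow> int) set \<Rightarrow> ('x \<times> int) measure \<Rightarrow> enat \<Rightarrow> real \<Rightarrow> (nat \<Rightarrow> real) \<Rightarrow> ereal" where
  "CAL_upper_bound c F P M \<delta> d = (case M of
      enat k \<Rightarrow> ereal (c *
        ((MAX m\<in>{0..k}. real (compression_bound F P m (d m)) *
            ln (exp 1 * real m / real (compression_bound F P m (d m))))
          + ln (log 2 (2 * real k) / \<delta>)) * log 2 (2 * real k))
    | \<infinity> \<Rightarrow> \<infinity>)"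

end

theory Submission
  imports Defs
begin

text \<open>The points queried by CAL form a compression set of the sample, so a label budget that
  suffices for CAL bounds the compression size at any time at which passive learning is still
  likely to fail; this gives the lower bound.

  For the upper bound, the points queried at times in \<open>{2 ^ i..<2 ^ (i + 2)}\<close> lie in the
  disagreement region of \<open>VS F (\<omega> ` I)\<close>, where \<open>I \<subseteq> {..<2 ^ i}\<close> indexes a small compression
  set of the first \<open>2 ^ i\<close> examples, while none of these examples lies in that region. For each
  fixed \<open>I\<close> it is exponentially unlikely that many later points hit a region that the examples
  outside \<open>I\<close> avoid, and a union bound over \<open>I\<close> yields the binomial coefficient behind
  \<open>B * ln (e * m / B)\<close>. The compression events alone may use up \<open>\<delta> / 2\<close> and failure of ERM at time
  \<open>k = M(\<epsilon>, \<delta> / 2)\<close> the other half, which leaves nothing for these deviations. Therefore CAL is run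
  until time \<open>2 * k\<close>, where ERM fails with probability at most \<open>(\<delta> / 2)\<^sup>2 \<le> \<delta> / 4\<close>.\<close>

subsection \<open>Spaces of i.i.d. sequences\<close>

lemma (in sequence_space) measurable_seqI:
  assumes "\<And>i. (\<lambda>x. f x i) \<in> N \<rightarrow>\<^sub>M M"
  shows "f \<in> N \<rightarrow>\<^sub>M S"
proof -
  have "(\<lambda>x. \<lambda>i\<in>UNIV. f x i) \<in> N \<rightarrow>\<^sub>M S"
    by (rule measurable_restrict) (use assms in auto)
  then show ?thesis by (simp add: restrict_UNIV)
qed

text \<open>Unlike \<open>comb_seq\<close>, which shifts the second sequence, splicing leaves every
  coordinate in place, so \<open>I\<close> may be an arbitrary index set.\<close>

definition splice_seq :: "nat set \<Rightarrow> (nat \<Rightarrow> 'a) \<Rightarrow> (nat \<Rightarrow> 'a) \<Rightarrow> nat \<Rightarrow> 'a" where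
  "splice_seq I \<omega> \<omega>' i = (if i \<in> I then \<omega> i else \<omega>' i)"

lemma (in sequence_space) measurable_splice_seq:
  "(\<lambda>(\<omega>, \<omega>'). splice_seq I \<omega> \<omega>') \<in> S \<Otimes>\<^sub>M S \<rightarrow>\<^sub>M S"
  by (rule measurable_seqI) (simp add: splice_seq_def split_beta')

text \<open>The preimage of a cylinder is a rectangle whose sides constrain the indices in
  \<open>J \<inter> I\<close> and in \<open>J - I\<close>. This is the means of conditioning on the
  coordinates in \<open>I\<close>: fix the first sequence and integrate over the second.\<close>

lemma (in sequence_space) PiM_splice_seq:
  "distr (S \<Otimes>\<^sub>M S) S (\<lambda>(\<omega>, \<omega>'). splice_seq I \<omega> \<omega>') = S" (is "?D = _")
proof (rule PiM_eq)
  let ?U = "UNIV::nat set" and ?M = "\<lambda>n. M"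
  let "distr _ _ ?f" = "?D"
  fix J E assume J: "finite J" "J \<subseteq> ?U" "\<And>j. j \<in> J \<Longrightarrow> E j \<in> sets M"
  let ?X = "prod_emb ?U ?M J (\<Pi>\<^sub>E j\<in>J. E j)"
  have "\<And>j x. j \<in> J \<Longrightarrow> x \<in> E j \<Longrightarrow> x \<in> space M"
    using J(3)[THEN sets.sets_into_space] by (auto simp: space_PiM Pi_iff subset_eq)
  with J have "?f -` ?X \<inter> space (S \<Otimes>\<^sub>M S) =
    (prod_emb ?U ?M (J \<inter> I) (\<Pi>\<^sub>E j\<in>J \<inter> I. E j)) \<times>
    (prod_emb ?U ?M (J - I) (\<Pi>\<^sub>E j\<in>J - I. E j))" (is "_ = ?E \<times> ?F")
    by (auto simp: space_pair_measure space_PiM prod_emb_def PiE_iff splice_seq_def split: if_splits)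
  then have "emeasure ?D ?X = emeasure (S \<Otimes>\<^sub>M S) (?E \<times> ?F)"
    by (subst emeasure_distr[OF measurable_splice_seq])
       (auto intro!: sets_PiM_I simp: split_beta' J)
  also have "\<dots> = emeasure S ?E * emeasure S ?F"
    using J by (intro P.emeasure_pair_measure_Times) (auto intro!: sets_PiM_I)
  also have "emeasure S ?F = (\<Prod>j\<in>J - I. emeasure M (E j))"
    using J by (intro emeasure_PiM_emb) simp_all
  also have "emeasure S ?E = (\<Prod>j\<in>J \<inter> I. emeasure M (E j))"
    using J by (intro emeasure_PiM_emb) simp_all
  also have "(\<Prod>j\<in>J \<inter> I. emeasure M (E j)) * (\<Prod>j\<in>J - I. emeasure M (E j)) = (\<Prod>j\<in>J. emeasure M (E j))"
    using J(1) by (subst prod.union_disjoint[symmetric]) (auto simp: Int_Diff_Un)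
  finally show "emeasure ?D ?X = (\<Prod>j\<in>J. emeasure M (E j))" .
qed simp_all

text \<open>The projection to \<open>K\<close> has the finite product measure as its law, and there
  such an integral factorizes.\<close>

lemma (in sequence_space) nn_integral_prod_coordinates:
  fixes g :: "nat \<Rightarrow> 'a \<Rightarrow> ennreal"
  assumes K: "finite K" and g: "\<And>i. i \<in> K \<Longrightarrow> g i \<in> borel_measurable M"
  shows "(\<integral>\<^sup>+\<omega>. (\<Prod>i\<in>K. g i (\<omega> i)) \<partial>S) = (\<Prod>i\<in>K. \<integral>\<^sup>+x. g i x \<partial>M)"
proof -
  interpret product_sigma_finite "\<lambda>_::nat. M" ..
  let ?r = "\<lambda>\<omega>. \<lambda>i\<in>K. \<omega> i"
  have r: "?r \<in> S \<rightarrow>\<^sub>M PiM K (\<lambda>_. M)"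
    by (rule measurable_restrict) auto
  have D: "distr S (PiM K (\<lambda>_. M)) ?r = PiM K (\<lambda>_. M)"
    using distr_PiM_reindex[of UNIV "\<lambda>_. M" id K] M.prob_space_axioms by simp
  have m: "(\<lambda>\<omega>. \<Prod>i\<in>K. g i (\<omega> i)) \<in> borel_measurable (PiM K (\<lambda>_. M))"
    by (rule borel_measurable_prod_ennreal)
      (use g in \<open>auto intro!: measurable_compose[OF measurable_component_singleton[of _ K "\<lambda>_. M"]]\<close>)
  have "(\<Prod>i\<in>K. \<integral>\<^sup>+x. g i x \<partial>M) = (\<integral>\<^sup>+\<omega>. (\<Prod>i\<in>K. g i (\<omega> i)) \<partial>PiM K (\<lambda>_. M))"
    by (rule product_nn_integral_prod[symmetric]) (use K g in auto)
  also have "\<dots> = (\<integral>\<^sup>+\<omega>. (\<Prod>i\<in>K. g i (\<omega> i)) \<partial>distr S (PiM K (\<lambda>_. M)) ?r)"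
    by (simp only: D)
  also have "\<dots> = (\<integral>\<^sup>+\<omega>. (\<Prod>i\<in>K. g i (?r \<omega> i)) \<partial>S)"
    by (rule nn_integral_distr[OF r]) (use m in simp)
  also have "\<dots> = (\<integral>\<^sup>+\<omega>. (\<Prod>i\<in>K. g i (\<omega> i)) \<partial>S)"
    by (intro nn_integral_cong prod.cong) auto
  finally show ?thesis by simp
qed

subsection \<open>Numerical estimates\<close>

lemma nat_floor_log2:
  assumes "1 \<le> k"
  shows "2 ^ nat \<lfloor>log 2 (real k)\<rfloor> \<le> k" "k < 2 ^ (nat \<lfloor>log 2 (real k)\<rfloor> + 1)"
    "real (nat \<lfloor>log 2 (real k)\<rfloor> + 1) \<le> log 2 (2 * real k)"
proof -
  have nn: "0 \<le> log 2 (real k)" using assms by simp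
  obtain L where L: "2 ^ L \<le> k" "k < 2 ^ (L + 1)"
    using ex_power_ivl1[of 2 k] assms by auto
  have "\<lfloor>log (real 2) (real k)\<rfloor> = int L"
    using floor_log_nat_eq_if[of 2 L k] L by simp
  then have *: "nat \<lfloor>log 2 (real k)\<rfloor> = L" by simp
  show "2 ^ nat \<lfloor>log 2 (real k)\<rfloor> \<le> k" "k < 2 ^ (nat \<lfloor>log 2 (real k)\<rfloor> + 1)"
    using L by (simp_all add: *)
  have "log 2 (2 * real k) = 1 + log 2 (real k)"
    using assms by (simp add: log_mult)
  then show "real (nat \<lfloor>log 2 (real k)\<rfloor> + 1) \<le> log 2 (2 * real k)"
    using nn by simp
qed

text \<open>Blocks ending at \<open>2 ^ (i + 1)\<close> would only reach \<open>2 ^ (L + 1)\<close>,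
  possibly short of \<open>2 * k\<close>. Doubling their ends covers the rest, while every block
  still starts at some \<open>2 ^ i \<le> k\<close>.\<close>

lemma dyadic_cover:
  assumes "2 ^ L \<le> k" "k < 2 ^ (L + 1)"
  shows "{..<2 * k} \<subseteq> {0} \<union> (\<Union>i\<le>L. {2 ^ i..<2 ^ (i + 2) :: nat})"
proof
  fix t assume "t \<in> {..<2 * k}"
  then have t: "t < 2 ^ (L + 2)" using assms(2) by simp
  show "t \<in> {0} \<union> (\<Union>i\<le>L. {2 ^ i..<2 ^ (i + 2)})"
  proof (cases "t = 0")
    case False
    then obtain j where j: "2 ^ j \<le> t" "t < 2 ^ (j + 1)"
      using ex_power_ivl1[of 2 t] by auto
    show ?thesis
    proof (cases "j \<le> L")
      case True
      have "(2::nat) ^ (j + 1) \<le> 2 ^ (j + 2)" by (rule power_increasing) auto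
      then show ?thesis using j True by (force intro: order_less_le_trans)
    next
      case False
      then have "(2::nat) ^ L \<le> 2 ^ j" by (intro power_increasing) auto
      then have "2 ^ L \<le> t" using j(1) by (rule order_trans)
      then have "t \<in> {2 ^ L..<2 ^ (L + 2)}" using t by simp
      then show ?thesis by blast
    qed
  qed simp
qed

lemma nonneg_mult_ln_exp_div:
  assumes "b \<le> m"
  shows "0 \<le> real b * ln (exp 1 * real m / real b)"
proof (cases "b = 0")
  case False
  have "1 * 1 \<le> exp 1 * (real m / real b)"
    using assms False by (intro mult_mono) auto
  then show ?thesis by (intro mult_nonneg_nonneg ln_ge_zero) auto
qed simp

text \<open>The binomial coefficient is at most \<open>m ^ b / fact b\<close>, and
  \<open>b ^ b / fact b\<close> is a term of the series of \<open>exp b\<close>. The additional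
  factor \<open>exp b\<close> makes room for the error term of
  \<open>emeasure_hits_outside_le\<close>; it is absorbed because \<open>m / b \<ge> 1\<close>, at
  the price of the factor \<open>2\<close> in the exponent.\<close>

lemma choose_mult_exp_le:
  assumes "b \<le> m"
  shows "real (m choose b) * exp (real b) \<le> exp (2 * (real b * ln (exp 1 * real m / real b)))"
proof (cases "b = 0")
  case False
  then have b: "real b > 0" and m: "real m > 0" using assms by auto
  have "real b ^ b / fact b = (\<Sum>n\<in>{b}. real b ^ n /\<^sub>R fact n)"
    by (simp add: divide_inverse mult.commute)
  also have "\<dots> \<le> (\<Sum>n. real b ^ n /\<^sub>R fact n)"
    by (intro sum_le_suminf summable_exp_generic) auto
  also have "\<dots> = exp (real b)" by (simp add: exp_def)
  finally have f: "real b ^ b / fact b \<le> exp (real b)" .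
  have q: "exp (real b * ln (exp 1 * real m / real b)) = exp (real b) * (real m / real b) ^ b"
  proof -
    have "exp (real b * ln (exp 1 * real m / real b)) = (exp 1 * real m / real b) ^ b"
      using b m by (simp add: exp_of_nat_mult)
    also have "\<dots> = exp 1 ^ b * (real m / real b) ^ b"
      by (simp add: power_mult_distrib flip: times_divide_eq_right)
    also have "exp (1::real) ^ b = exp (real b)"
      using exp_of_nat_mult[of b "1::real"] by simp
    finally show ?thesis .
  qed
  have "real (m choose b) \<le> real m ^ b / fact b"
  proof -
    have "(m choose b) * fact b \<le> m ^ b" by (rule binomial_fact_pow)
    then have "real ((m choose b) * fact b) \<le> real (m ^ b)" by (simp only: of_nat_le_iff)
    then show ?thesis by (simp add: field_simps)
  qed
  also have "\<dots> = (real b ^ b / fact b) * (real m / real b) ^ b"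
    using b by (simp add: power_divide)
  also have "\<dots> \<le> exp (real b) * (real m / real b) ^ b"
    using f by (intro mult_right_mono) auto
  finally have 1: "real (m choose b) \<le> exp (real b * ln (exp 1 * real m / real b))"
    unfolding q .
  have "(real m / real b) ^ b \<ge> 1"
    using assms b by (intro one_le_power) auto
  then have 2: "exp (real b) \<le> exp (real b * ln (exp 1 * real m / real b))"
    unfolding q by simp
  show ?thesis
    using mult_mono[OF 1 2] unfolding mult_2 exp_add by simp
qed auto

subsection \<open>Hits of a sample-dependent region\<close>

text \<open>The region depends on the set of observed points only, not on their order. Hence
  measurability for initial segments carries over to all finite index sets.\<close>

locale sample_region = sequence_space M for M :: "'a measure" +
  fixes R :: "'a set \<Rightarrow> 'a set"
  assumes sets_next: "{\<omega> \<in> space S. \<omega> t \<in> R (\<omega> ` {..<t})} \<in> sets S"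
begin

text \<open>The map \<open>r\<close> lists the coordinates in \<open>I\<close> first and puts
  \<open>\<omega> t\<close> right after them, which turns the event into one about an initial
  segment.\<close>

lemma sets_hit:
  assumes "finite I"
  shows "{\<omega> \<in> space S. \<omega> t \<in> R (\<omega> ` I)} \<in> sets S"
proof -
  obtain h where "bij_betw h {0..<card I} I"
    using ex_bij_betw_nat_finite[OF assms] by blast
  then have h: "h ` {..<card I} = I"
    by (simp add: bij_betw_def atLeast0LessThan)
  define r where "r \<omega> i = (if i < card I then \<omega> (h i) else \<omega> t)" for \<omega> :: "nat \<Rightarrow> 'a" and i
  have r: "r \<in> S \<rightarrow>\<^sub>M S"
    by (rule measurable_seqI) (simp add: r_def)
  have img: "r \<omega> ` {..<card I} = \<omega> ` I" for \<omega>
  proof -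
    have "r \<omega> ` {..<card I} = (\<lambda>i. \<omega> (h i)) ` {..<card I}"
      by (rule image_cong) (auto simp: r_def)
    also have "\<dots> = \<omega> ` I" by (simp add: h flip: image_image)
    finally show ?thesis .
  qed
  have "{\<omega> \<in> space S. \<omega> t \<in> R (\<omega> ` I)} =
      r -` {\<omega> \<in> space S. \<omega> (card I) \<in> R (\<omega> ` {..<card I})} \<inter> space S"
    using measurable_space[OF r] by (auto simp: img) (auto simp: r_def)
  then show ?thesis
    using measurable_sets[OF r sets_next] by simp
qed

text \<open>Varying one coordinate \<open>t\<close> outside \<open>I\<close> leaves the image of
  \<open>I\<close> unchanged, so the region is a section of the event in
  \<open>sets_hit\<close>.\<close>

lemma sets_section:
  assumes "finite I" "\<omega> \<in> space S"
  shows "{x \<in> space M. x \<in> R (\<omega> ` I)} \<in> sets M"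
proof -
  obtain t where t: "t \<notin> I"
    using ex_new_if_finite[OF infinite_UNIV_nat assms(1)] by blast
  have w: "\<omega> i \<in> space M" for i
    using assms(2) by (auto simp: space_PiM)
  define u where "u x i = (if i = t then x else \<omega> i)" for x i
  have r: "u \<in> M \<rightarrow>\<^sub>M S"
    by (rule measurable_seqI) (simp add: u_def w)
  have img: "u x ` I = \<omega> ` I" for x
    using t by (intro image_cong) (auto simp: u_def)
  have "{x \<in> space M. x \<in> R (\<omega> ` I)} = u -` {\<omega> \<in> space S. \<omega> t \<in> R (\<omega> ` I)} \<inter> space M"
    using measurable_space[OF r] by (auto simp: img) (auto simp: u_def)
  then show ?thesis
    using measurable_sets[OF r sets_hit[OF assms(1)]] by simp
qed

lemma sets_hits_outside:
  assumes "finite I" "finite A" "finite B"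
  shows "{\<omega> \<in> space S. (\<forall>t\<in>A. \<omega> t \<notin> R (\<omega> ` I)) \<and>
      \<kappa> \<le> real (card {t \<in> B. \<omega> t \<in> R (\<omega> ` I)})} \<in> sets S"
proof -
  have *: "{\<omega> \<in> space S. \<kappa> \<le> real (card {t \<in> B. \<omega> t \<in> R (\<omega> ` I)})} =
      {\<omega> \<in> space S. \<kappa> \<le> (\<Sum>t\<in>B. indicator {\<omega> \<in> space S. \<omega> t \<in> R (\<omega> ` I)} \<omega>)}"
    using assms(3) by (auto simp: indicator_def sum.If_cases Int_def)
  have "{\<omega> \<in> space S. \<kappa> \<le> (\<Sum>t\<in>B. indicator {\<omega> \<in> space S. \<omega> t \<in> R (\<omega> ` I)} \<omega>)} \<in> sets S"
    using sets_hit[OF assms(1)] by measurable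
  moreover have "{\<omega> \<in> space S. \<forall>t\<in>A. \<omega> t \<notin> R (\<omega> ` I)} \<in> sets S"
    by (intro sets.sets_Collect_finite_All sets.sets_Collect_neg sets_hit assms)
  ultimately show ?thesis
    unfolding *[symmetric] by (intro sets.sets_Collect_conj)
qed

text \<open>Given \<open>\<omega> ` I\<close>, the points outside \<open>I\<close> hit the region independently with the same
  probability \<open>p\<close>. No hit in \<open>A\<close> costs a factor \<open>(1 - p) ^ card A\<close>, which compensates the
  bound \<open>(1 + p / 3) ^ card B\<close> on the expectation of \<open>exp (h / 4)\<close> for the number \<open>h\<close> of hits
  in \<open>B\<close>.\<close>

lemma emeasure_hits_outside_le:
  assumes fin: "finite I" "finite A" "finite B"
    and disj: "I \<inter> A = {}" "I \<inter> B = {}" "A \<inter> B = {}"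
    and card: "card B \<le> 3 * (card A + card I)"
  shows "emeasure S {\<omega> \<in> space S. (\<forall>t\<in>A. \<omega> t \<notin> R (\<omega> ` I)) \<and>
      \<kappa> \<le> real (card {t \<in> B. \<omega> t \<in> R (\<omega> ` I)})} \<le> ennreal (exp (real (card I) - \<kappa> / 4))"
    (is "emeasure S ?E \<le> _")
proof -
  have E: "?E \<in> sets S"
    by (rule sets_hits_outside[OF fin])
  \<comment> \<open>With \<open>\<omega>\<close> fixed, the region is a fixed set \<open>D\<close>,
    and the coordinates in \<open>A\<close> and \<open>B\<close> all come from
    \<open>\<omega>'\<close>.\<close>
  have inner: "(\<integral>\<^sup>+\<omega>'. indicator ?E (splice_seq I \<omega> \<omega>') \<partial>S) \<le> ennreal (exp (real (card I) - \<kappa> / 4))"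
    if \<omega>: "\<omega> \<in> space S" for \<omega>
  proof -
    define D where "D = {x \<in> space M. x \<in> R (\<omega> ` I)}"
    have D: "D \<in> sets M" unfolding D_def by (rule sets_section[OF fin(1) \<omega>])
    define p where "p = measure M D"
    have p: "0 \<le> p" "p \<le> 1" by (auto simp: p_def)
    have eD: "emeasure M D = ennreal p" "emeasure M (space M - D) = ennreal (1 - p)"
      using D by (simp_all add: p_def M.emeasure_eq_measure M.prob_compl)
    \<comment> \<open>Exponential moment method: a hit in \<open>A\<close> has weight
      \<open>0\<close>, a hit in \<open>B\<close> weight \<open>exp (1/4)\<close>, a miss weight
      \<open>1\<close>. Scaled by \<open>exp (- \<kappa> / 4)\<close>, the product of the weights
      dominates the indicator of the event.\<close>
    define g :: "nat \<Rightarrow> 'a \<Rightarrow> ennreal" where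
      "g t x = (if t \<in> A then 0 else ennreal (exp (1/4))) * indicator D x + indicator (space M - D) x"
      for t x
    have g: "g t \<in> borel_measurable M" for t
      unfolding g_def using D by measurable
    have int_g: "(\<integral>\<^sup>+x. g t x \<partial>M) \<le> ennreal (if t \<in> A then exp (- p) else exp (p / 3))" for t
    proof -
      \<comment> \<open>This bounds the expected weight in \<open>B\<close> by
        \<open>1 + p / 3\<close>, where \<open>1 / 3\<close> matches the \<open>3\<close> in the
        cardinality hypothesis.\<close>
      have e: "exp (1/4 :: real) \<le> 4 / 3"
      proof -
        have "exp (-(1/4) :: real) \<ge> 1 - 1/4" using exp_ge_add_one_self[of "-(1/4) :: real"] by simp
        then show ?thesis by (simp add: exp_minus field_simps)
      qed
      have "(\<integral>\<^sup>+x. g t x \<partial>M) = (if t \<in> A then 0 else ennreal (exp (1/4))) * ennreal p + ennreal (1 - p)"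
        unfolding g_def using D by (subst nn_integral_add) (auto simp: nn_integral_cmult eD)
      also have "\<dots> = ennreal ((if t \<in> A then 0 else exp (1/4)) * p + (1 - p))"
        using p by (auto simp flip: ennreal_mult ennreal_plus)
      also have "\<dots> \<le> ennreal (if t \<in> A then exp (- p) else exp (p / 3))"
      proof (rule ennreal_leI)
        have "exp (1/4) * p + (1 - p) \<le> exp (p / 3)"
          using mult_right_mono[OF e p(1)] exp_ge_add_one_self[of "p / 3"] by linarith
        moreover have "1 - p \<le> exp (- p)"
          using exp_ge_add_one_self[of "- p"] by simp
        ultimately show "(if t \<in> A then 0 else exp (1/4)) * p + (1 - p)
            \<le> (if t \<in> A then exp (- p) else exp (p / 3))" by auto
      qed
      finally show ?thesis .
    qed
    have pt: "indicator ?E (splice_seq I \<omega> \<omega>') \<le> ennreal (exp (- \<kappa> / 4)) * (\<Prod>t\<in>A \<union> B. g t (\<omega>' t))"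
      if \<omega>': "\<omega>' \<in> space S" for \<omega>'
    proof (cases "splice_seq I \<omega> \<omega>' \<in> ?E")
      case True
      have w: "\<omega>' i \<in> space M" for i using \<omega>' by (auto simp: space_PiM)
      have img: "splice_seq I \<omega> \<omega>' ` I = \<omega> ` I"
        by (intro image_cong) (auto simp: splice_seq_def)
      have sp: "splice_seq I \<omega> \<omega>' t = \<omega>' t" if "t \<in> A \<union> B" for t
        using that disj by (auto simp: splice_seq_def)
      have 1: "g t (\<omega>' t) = 1" if "t \<in> A" for t
      proof -
        have "splice_seq I \<omega> \<omega>' t \<notin> R (splice_seq I \<omega> \<omega>' ` I)"
          using True that by simp
        then have "\<omega>' t \<notin> R (\<omega> ` I)" using sp that by (simp add: img)
        then show ?thesis using that w by (simp add: g_def D_def)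
      qed
      have "{t \<in> B. splice_seq I \<omega> \<omega>' t \<in> R (splice_seq I \<omega> \<omega>' ` I)} = {t \<in> B. \<omega>' t \<in> D}"
        using w by (auto simp: img sp D_def)
      then have \<kappa>: "\<kappa> \<le> real (card {t \<in> B. \<omega>' t \<in> D})"
        using True by simp
      have "(\<Prod>t\<in>B. g t (\<omega>' t)) = (\<Prod>t\<in>B. if \<omega>' t \<in> D then ennreal (exp (1/4)) else 1)"
        using disj(3) w by (intro prod.cong) (auto simp: g_def)
      also have "\<dots> = ennreal (exp (1/4)) ^ card {t \<in> B. \<omega>' t \<in> D}"
        using fin(3) by (simp add: prod.If_cases Int_def)
      also have "\<dots> = ennreal (exp (real (card {t \<in> B. \<omega>' t \<in> D}) / 4))"
        by (simp add: ennreal_power flip: exp_of_nat_mult)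
      finally have 2: "(\<Prod>t\<in>B. g t (\<omega>' t)) = ennreal (exp (real (card {t \<in> B. \<omega>' t \<in> D}) / 4))" .
      have "(\<Prod>t\<in>A \<union> B. g t (\<omega>' t)) = (\<Prod>t\<in>A. g t (\<omega>' t)) * (\<Prod>t\<in>B. g t (\<omega>' t))"
        using fin disj by (intro prod.union_disjoint) auto
      also have "(\<Prod>t\<in>A. g t (\<omega>' t)) = 1" using 1 by simp
      finally have "ennreal (exp (- \<kappa> / 4)) * (\<Prod>t\<in>A \<union> B. g t (\<omega>' t)) =
          ennreal (exp ((real (card {t \<in> B. \<omega>' t \<in> D}) - \<kappa>) / 4))"
        unfolding 2 by (simp add: diff_divide_distrib flip: ennreal_mult exp_add)
      also have "\<dots> \<ge> ennreal 1" using \<kappa> by (intro ennreal_leI) simp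
      finally show ?thesis using True by simp
    qed simp
    have "(\<integral>\<^sup>+\<omega>'. indicator ?E (splice_seq I \<omega> \<omega>') \<partial>S)
        \<le> (\<integral>\<^sup>+\<omega>'. ennreal (exp (- \<kappa> / 4)) * (\<Prod>t\<in>A \<union> B. g t (\<omega>' t)) \<partial>S)"
      by (intro nn_integral_mono pt)
    also have "\<dots> = ennreal (exp (- \<kappa> / 4)) * (\<integral>\<^sup>+\<omega>'. (\<Prod>t\<in>A \<union> B. g t (\<omega>' t)) \<partial>S)"
      by (intro nn_integral_cmult borel_measurable_prod_ennreal measurable_compose[OF _ g]) auto
    also have "(\<integral>\<^sup>+\<omega>'. (\<Prod>t\<in>A \<union> B. g t (\<omega>' t)) \<partial>S) = (\<Prod>t\<in>A \<union> B. \<integral>\<^sup>+x. g t x \<partial>M)"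
      using fin g by (intro nn_integral_prod_coordinates) auto
    also have "\<dots> \<le> (\<Prod>t\<in>A \<union> B. ennreal (if t \<in> A then exp (- p) else exp (p / 3)))"
      by (intro prod_mono_ennreal int_g)
    also have "\<dots> = (\<Prod>t\<in>A. ennreal (exp (- p))) * (\<Prod>t\<in>B. ennreal (exp (p / 3)))"
      using fin disj
      by (subst prod.union_disjoint) (auto intro!: arg_cong2[where f="(*)"] prod.cong simp del: prod_constant)
    also have "\<dots> = ennreal (exp (p * (real (card B) / 3 - real (card A))))"
      by (simp add: ennreal_power algebra_simps flip: exp_of_nat_mult ennreal_mult exp_add)
    also have "ennreal (exp (- \<kappa> / 4)) * \<dots> \<le> ennreal (exp (real (card I) - \<kappa> / 4))"
    proof -
      \<comment> \<open>The indices in \<open>I\<close> are missing from \<open>A\<close>, so the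
        compensation falls short by at most \<open>p * card I\<close>. This is the source of
        \<open>exp (card I)\<close>.\<close>
      have "p * (real (card B) / 3 - real (card A)) \<le> p * real (card I)"
        using card p by (intro mult_left_mono) auto
      also have "\<dots> \<le> real (card I)" using p by (simp add: mult_left_le_one_le)
      finally show ?thesis by (auto intro!: ennreal_leI simp flip: ennreal_mult exp_add)
    qed
    finally show ?thesis by (simp add: mult_left_mono)
  qed
  have "emeasure S ?E = (\<integral>\<^sup>+z. indicator ?E z \<partial>distr (S \<Otimes>\<^sub>M S) S (\<lambda>(\<omega>, \<omega>'). splice_seq I \<omega> \<omega>'))"
    using E by (simp add: PiM_splice_seq)
  also have "\<dots> = (\<integral>\<^sup>+(\<omega>, \<omega>'). indicator ?E (splice_seq I \<omega> \<omega>') \<partial>(S \<Otimes>\<^sub>M S))"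
    using E by (subst nn_integral_distr[OF measurable_splice_seq]) (auto simp: split_beta')
  also have "\<dots> = (\<integral>\<^sup>+\<omega>. \<integral>\<^sup>+\<omega>'. indicator ?E (splice_seq I \<omega> \<omega>') \<partial>S \<partial>S)"
    using measurable_compose[OF measurable_splice_seq borel_measurable_indicator[OF E]]
    by (subst P.nn_integral_fst[symmetric]) (auto simp: split_beta')
  also have "\<dots> \<le> (\<integral>\<^sup>+\<omega>. ennreal (exp (real (card I) - \<kappa> / 4)) \<partial>S)"
    by (intro nn_integral_mono inner)
  also have "\<dots> = ennreal (exp (real (card I) - \<kappa> / 4))"
    by (simp add: P.emeasure_space_1)
  finally show ?thesis .
qed

text \<open>\<open>I\<close> stands for the indices of a compression set of the first
  \<open>m\<close> examples. Its size is exactly \<open>b\<close>, so that the union bound runs over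
  \<open>m choose b\<close> sets.\<close>

definition compressed_hits :: "nat \<Rightarrow> nat \<Rightarrow> nat set \<Rightarrow> real \<Rightarrow> (nat \<Rightarrow> 'a) set" where
  "compressed_hits m b B \<kappa> = {\<omega> \<in> space S. \<exists>I\<subseteq>{..<m}. card I = b \<and>
    (\<forall>t\<in>{..<m} - I. \<omega> t \<notin> R (\<omega> ` I)) \<and> \<kappa> \<le> real (card {t \<in> B. \<omega> t \<in> R (\<omega> ` I)})}"

lemma compressed_hits_eq:
  "compressed_hits m b B \<kappa> = (\<Union>I\<in>{I. I \<subseteq> {..<m} \<and> card I = b}.
    {\<omega> \<in> space S. (\<forall>t\<in>{..<m} - I. \<omega> t \<notin> R (\<omega> ` I)) \<and>
      \<kappa> \<le> real (card {t \<in> B. \<omega> t \<in> R (\<omega> ` I)})})"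
  by (auto simp: compressed_hits_def)

lemma sets_compressed_hits:
  assumes "finite B"
  shows "compressed_hits m b B \<kappa> \<in> sets S"
  unfolding compressed_hits_eq
  by (intro sets.finite_UN sets_hits_outside assms) (auto intro: finite_subset)

text \<open>Union bound over the index sets. For each of them \<open>A = {..<m} - I\<close> gives
  \<open>card A + card I = m\<close>, so \<open>card B \<le> 3 * m\<close> is the size condition of
  \<open>emeasure_hits_outside_le\<close>.\<close>

lemma prob_compressed_hits_le:
  assumes b: "b \<le> m" and B: "finite B" "B \<inter> {..<m} = {}" "card B \<le> 3 * m"
  shows "P.prob (compressed_hits m b B \<kappa>)
    \<le> exp (2 * (real b * ln (exp 1 * real m / real b)) - \<kappa> / 4)"
proof -
  let ?J = "{I. I \<subseteq> {..<m} \<and> card I = b}"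
  let ?E = "\<lambda>I. {\<omega> \<in> space S. (\<forall>t\<in>{..<m} - I. \<omega> t \<notin> R (\<omega> ` I)) \<and>
      \<kappa> \<le> real (card {t \<in> B. \<omega> t \<in> R (\<omega> ` I)})}"
  have fin: "finite I" if "I \<in> ?J" for I
    using that by (auto intro: finite_subset)
  have J: "finite ?J" "card ?J = m choose b"
    using n_subsets[of "{..<m}" b] by auto
  have "P.prob (\<Union>I\<in>?J. ?E I) \<le> (\<Sum>I\<in>?J. P.prob (?E I))"
    using fin B J by (intro P.finite_measure_subadditive_finite) (auto intro!: sets_hits_outside)
  also have "\<dots> \<le> (\<Sum>I\<in>?J. exp (real b - \<kappa> / 4))"
  proof (rule sum_mono)
    fix I assume I: "I \<in> ?J"
    have "card ({..<m} - I) + card I = m"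
      using I fin[OF I] card_mono[of "{..<m}" I] by (subst card_Diff_subset) auto
    then have "emeasure S (?E I) \<le> ennreal (exp (real (card I) - \<kappa> / 4))"
      using I fin[OF I] B by (intro emeasure_hits_outside_le) auto
    then show "P.prob (?E I) \<le> exp (real b - \<kappa> / 4)"
      using I by (simp add: P.emeasure_eq_measure)
  qed
  also have "\<dots> = (real (m choose b) * exp (real b)) * exp (- \<kappa> / 4)"
    unfolding sum_constant J by (simp add: mult.assoc flip: exp_add)
  also have "\<dots> \<le> exp (2 * (real b * ln (exp 1 * real m / real b))) * exp (- \<kappa> / 4)"
    by (intro mult_right_mono choose_mult_exp_le b) simp
  finally show ?thesis
    unfolding compressed_hits_eq by (simp flip: exp_add)
qed

end

subsection \<open>Version spaces and CAL on a fixed sequence\<close>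

lemma sample_enat: "sample (enat m) \<omega> = \<omega> ` {..<m}"
  by (auto simp: sample_def)

lemma sample_mono: "m \<le> n \<Longrightarrow> sample m \<omega> \<subseteq> sample n \<omega>"
  by (auto simp: sample_def intro: order_less_le_trans)

lemma mem_VS_iff: "h \<in> VS F T \<longleftrightarrow> h \<in> F \<and> (\<forall>z\<in>T. h (fst z) = snd z)"
  by (auto simp: VS_def)

lemma VS_antimono: "A \<subseteq> B \<Longrightarrow> VS F B \<subseteq> VS F A"
  by (auto simp: VS_def)

lemma VS_Un: "VS F (A \<union> B) = VS F A \<inter> VS F B"
  by (auto simp: mem_VS_iff)

lemma DIS_mono: "G \<subseteq> H \<Longrightarrow> DIS X G \<subseteq> DIS X H"
  by (auto simp: DIS_def)

lemma sup_er_mono: "G \<subseteq> H \<Longrightarrow> sup_er P G \<le> sup_er P H"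
  unfolding sup_er_def by (rule SUP_subset_mono) auto

lemma sample_notin_DIS: "z \<in> C \<Longrightarrow> fst z \<notin> DIS X (VS F C)"
  by (auto simp: DIS_def mem_VS_iff)

lemma compression_size_le_card:
  assumes "C \<subseteq> T" "VS F C = VS F T"
  shows "compression_size F T \<le> card C"
  unfolding compression_size_def by (rule Least_le) (use assms in blast)

lemma compression_size_witness:
  obtains C where "C \<subseteq> T" "card C = compression_size F T" "VS F C = VS F T"
proof -
  have "\<exists>k. \<exists>C\<subseteq>T. card C = k \<and> VS F C = VS F T" by blast
  from LeastI_ex[OF this] show ?thesis
    using that unfolding compression_size_def by blast
qed

lemma compression_size_sample_le: "compression_size F (sample (enat m) \<omega>) \<le> m"
  using compression_size_le_card[of "sample (enat m) \<omega>" "sample (enat m) \<omega>" F]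
    card_image_le[of "{..<m}" \<omega>] by (simp add: sample_enat)

text \<open>Compression sets are closed under supersets within the sample, so their index sets may be
  padded to a prescribed size.\<close>

lemma compression_index_set:
  assumes "compression_size F (sample (enat m) \<omega>) \<le> b" "b \<le> m"
  obtains I where "I \<subseteq> {..<m}" "card I = b" "VS F (\<omega> ` I) = VS F (\<omega> ` {..<m})"
proof -
  obtain C where C: "C \<subseteq> \<omega> ` {..<m}" "card C \<le> b" "VS F C = VS F (\<omega> ` {..<m})"
    using compression_size_witness[of "sample (enat m) \<omega>" F] assms(1)
    unfolding sample_enat by metis
  \<comment> \<open>Injectivity on \<open>J\<close> keeps \<open>card J = card C\<close> even if the
    sample repeats examples.\<close>
  obtain J where J: "J \<subseteq> {..<m}" "inj_on \<omega> J" "\<omega> ` J = C"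
    using C(1) by (metis subset_image_inj)
  then have "card J \<le> b" using C(2) card_image by metis
  then obtain I where I: "J \<subseteq> I" "I \<subseteq> {..<m}" "card I = b"
    using exists_subset_between[of J b "{..<m}"] J(1) assms(2) by auto
  have "VS F (\<omega> ` {..<m}) \<subseteq> VS F (\<omega> ` I)" "VS F (\<omega> ` I) \<subseteq> VS F C"
    using I J by (auto intro!: VS_antimono)
  then show ?thesis using that I C(3) by blast
qed

section \<open>Label counts and the stopping time of CAL\<close>

lemma num_labels_0 [simp]: "num_labels X F 0 \<omega> = 0"
  by (simp add: num_labels_def)

lemma num_labels_Suc: "num_labels X F (Suc m) \<omega> =
    num_labels X F m \<omega> + of_bool (fst (\<omega> m) \<in> DIS X (VS F (\<omega> ` {..<m})))"
  by (simp add: num_labels_def sample_enat)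

lemma num_labels_eq_card:
  "num_labels X F m \<omega> = card {t \<in> {..<m}. fst (\<omega> t) \<in> DIS X (VS F (\<omega> ` {..<t}))}"
  by (simp add: num_labels_def sample_enat of_bool_def sum.If_cases Int_def)

lemma num_labels_mono: "m \<le> n \<Longrightarrow> num_labels X F m \<omega> \<le> num_labels X F n \<omega>"
  unfolding num_labels_def by (rule sum_mono2) auto

text \<open>A discrete intermediate value property: the count starts at \<open>0\<close> and
  increases by at most \<open>1\<close> per step.\<close>

lemma num_labels_intermediate:
  assumes "n \<le> num_labels X F m \<omega>"
  obtains k where "k \<le> m" "num_labels X F k \<omega> = n"
proof -
  have "\<exists>k\<le>m. num_labels X F k \<omega> = n"
    using assms
  proof (induction m)
    case (Suc m)
    show ?case
    proof (cases "n \<le> num_labels X F m \<omega>")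
      case True
      then show ?thesis using Suc.IH le_SucI by blast
    next
      case False
      then have "num_labels X F (Suc m) \<omega> = n"
        using Suc.prems by (auto simp: num_labels_Suc of_bool_def split: if_splits)
      then show ?thesis by blast
    qed
  qed simp
  then show ?thesis using that by blast
qed

text \<open>The count is monotone. If it never equals \<open>n\<close>, the infimum is over the
  empty set, and the bound still holds.\<close>

lemma le_CAL_time_if_num_labels_less:
  assumes "num_labels X F m \<omega> < n"
  shows "enat m \<le> CAL_time X F n \<omega>"
  unfolding CAL_time_def
proof (rule Inf_greatest)
  fix x assume "x \<in> {enat k | k. k \<ge> 1 \<and> num_labels X F k \<omega> = n}"
  then obtain k where x: "x = enat k" and "num_labels X F k \<omega> = n" by blast
  then have "m \<le> k" using assms num_labels_mono[of k m X F \<omega>] by (metis leD nle_le)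
  then show "enat m \<le> x" by (simp add: x)
qed

text \<open>A count above \<open>n\<close> at time \<open>m\<close> would have passed through
  \<open>n\<close> at an earlier time.\<close>

lemma num_labels_le_if_le_CAL_time:
  assumes "1 \<le> n" "enat m \<le> CAL_time X F n \<omega>"
  shows "num_labels X F m \<omega> \<le> n"
proof (rule ccontr)
  assume *: "\<not> num_labels X F m \<omega> \<le> n"
  then obtain k where k: "k \<le> m" "num_labels X F k \<omega> = n"
    using num_labels_intermediate[of n X F m \<omega>] by auto
  \<comment> \<open>\<open>CAL_time\<close> ranges over positive times only; the count at time
    \<open>0\<close> is \<open>0\<close>, so it differs from \<open>n\<close>.\<close>
  then have "k \<ge> 1" using assms(1) by (cases k) auto
  then have "CAL_time X F n \<omega> \<le> enat k"
    unfolding CAL_time_def using k by (intro Inf_lower) auto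
  then have "m \<le> k" using assms(2) by (metis enat_ord_simps(1) order_trans)
  then show False using k * by auto
qed

text \<open>The queried examples form a compression set: at an unqueried point the version space is
  already unanimous, and since it contains the consistent \<open>f\<close>, its common label is the
  observed one. Adding this example removes no classifier.\<close>

lemma compression_size_le_num_labels:
  assumes "f \<in> F" and cons: "\<And>t. snd (\<omega> t) = f (fst (\<omega> t))" and sp: "\<And>t. fst (\<omega> t) \<in> space X"
  shows "compression_size F (sample (enat m) \<omega>) \<le> num_labels X F m \<omega>"
proof -
  define Q where "Q m = {t \<in> {..<m}. fst (\<omega> t) \<in> DIS X (VS F (\<omega> ` {..<t}))}" for m
  have "VS F (\<omega> ` Q m) = VS F (\<omega> ` {..<m})"
  proof (induction m)
    case 0
    show ?case by (simp add: Q_def)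
  next
    case (Suc m)
    have step: "VS F (\<omega> ` {..<Suc m}) = VS F {\<omega> m} \<inter> VS F (\<omega> ` {..<m})"
      by (simp add: lessThan_Suc flip: VS_Un)
    show ?case
    proof (cases "fst (\<omega> m) \<in> DIS X (VS F (\<omega> ` {..<m}))")
      case True
      then have "Q (Suc m) = insert m (Q m)" by (auto simp: Q_def less_Suc_eq)
      then have "VS F (\<omega> ` Q (Suc m)) = VS F {\<omega> m} \<inter> VS F (\<omega> ` Q m)"
        by (simp flip: VS_Un)
      then show ?thesis using Suc.IH step by simp
    next
      case False
      then have Q: "Q (Suc m) = Q m" by (auto simp: Q_def less_Suc_eq)
      have f: "f \<in> VS F (\<omega> ` {..<m})"
        using assms(1) cons by (auto simp: VS_def) (metis prod.sel)
      have "h (fst (\<omega> m)) = f (fst (\<omega> m))" if "h \<in> VS F (\<omega> ` {..<m})" for h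
        using False f that sp[of m] unfolding DIS_def by blast
      then have "VS F (\<omega> ` {..<m}) \<subseteq> VS F {\<omega> m}"
        using cons[of m] by (auto simp: VS_def split: prod.splits)
      then show ?thesis using Q Suc.IH step by auto
    qed
  qed
  moreover have "\<omega> ` Q m \<subseteq> \<omega> ` {..<m}" by (auto simp: Q_def)
  ultimately have "compression_size F (sample (enat m) \<omega>) \<le> card (\<omega> ` Q m)"
    unfolding sample_enat by (intro compression_size_le_card)
  also have "\<dots> \<le> card (Q m)" by (rule card_image_le) (simp add: Q_def)
  also have "\<dots> = num_labels X F m \<omega>" by (simp add: num_labels_eq_card Q_def)
  finally show ?thesis .
qed

subsection \<open>Label complexity of CAL\<close>

lemma prob_ERM_good_event_less: "enat m < sample_complexity F P \<epsilon> \<delta> \<Longrightarrow> 1 \<le> m \<Longrightarrow>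
    measure (seq_space P) (ERM_good_event F P \<epsilon> m) < 1 - \<delta>"
  unfolding sample_complexity_def
  by (metis (mono_tags, lifting) Inf_lower leD mem_Collect_eq not_less)

locale active_learning =
  fixes X :: "'x measure" and F :: "('x \<Rightarrow> int) set" and P :: "('x \<times> int) measure" and \<epsilon> :: real
  assumes prob_space_P: "prob_space P"
    and sets_P: "sets P = sets (X \<Otimes>\<^sub>M label_space)"
    and events: "measurable_events X F P \<epsilon>"

text \<open>The region of \<open>C\<close> consists of the examples whose instance CAL would query
  after observing \<open>C\<close>, so \<open>sets_next\<close> is the measurability of a label
  request.\<close>

sublocale active_learning \<subseteq> sample_region P "\<lambda>C. {z. fst z \<in> DIS X (VS F C)}"
proof -
  interpret prob_space P by (rule prob_space_P)
  interpret sequence_space P ..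
  show "sample_region P (\<lambda>C. {z. fst z \<in> DIS X (VS F C)})"
    by unfold_locales
      (use events in \<open>simp add: measurable_events_def seq_space_def sample_enat\<close>)
qed

context active_learning
begin

lemma sets_compression_event: "compression_event F P m b \<in> sets S"
  and sets_ERM_good_event: "ERM_good_event F P \<epsilon> m \<in> sets S"
  and sets_CAL_good_event: "1 \<le> n \<Longrightarrow> CAL_good_event X F P \<epsilon> n \<in> sets S"
  using events by (simp_all add: measurable_events_def seq_space_def)

lemma fst_mem_space: "\<omega> \<in> space S \<Longrightarrow> fst (\<omega> t) \<in> space X"
  using sets_eq_imp_space_eq[OF sets_P] by (auto simp: space_PiM space_pair_measure PiE_iff mem_Times_iff)

lemma compression_event_eq_space: "m \<le> b \<Longrightarrow> compression_event F P m b = space S"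
  using compression_size_sample_le[of F m]
  by (auto simp: compression_event_def seq_space_def intro: order_trans)

lemma compression_bound_le:
  assumes "0 \<le> \<delta>" "1 - \<delta> \<le> P.prob (compression_event F P m b)"
  shows "compression_bound F P m \<delta> \<le> b"
  unfolding compression_bound_def by (rule Least_le) (use assms in \<open>simp add: seq_space_def\<close>)

lemma compression_bound_le_size: "0 \<le> \<delta> \<Longrightarrow> compression_bound F P m \<delta> \<le> m"
  by (rule compression_bound_le) (simp_all add: compression_event_eq_space P.prob_space)

lemma prob_compression_event_bound:
  assumes "0 \<le> \<delta>"
  shows "1 - \<delta> \<le> P.prob (compression_event F P m (compression_bound F P m \<delta>))"
proof -
  have "1 - \<delta> \<le> measure (seq_space P) (compression_event F P m m)"
    using assms by (simp add: compression_event_eq_space P.prob_space seq_space_def)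
  then have "1 - \<delta> \<le> measure (seq_space P) (compression_event F P m (compression_bound F P m \<delta>))"
    unfolding compression_bound_def by (rule LeastI)
  then show ?thesis by (simp add: seq_space_def)
qed

section \<open>The lower bound on the label complexity\<close>

text \<open>On the good event of CAL there are two cases. If the \<open>n\<close>-th label is not
  requested before time \<open>m\<close>, the compression size at time \<open>m\<close> is at most
  \<open>n\<close>. Otherwise passive learning has already succeeded at time \<open>m - 1\<close>,
  which has probability below \<open>\<gamma>\<close> by minimality of the sample
  complexity.\<close>

lemma compression_bound_le_budget:
  assumes f: "f \<in> F" "realizable P f"
    and "0 \<le> \<gamma>" "0 \<le> \<delta>"
    and m: "enat m \<le> sample_complexity F P \<epsilon> (1 - \<gamma>)"
    and n: "1 \<le> n" "1 - \<delta> \<le> P.prob (CAL_good_event X F P \<epsilon> n)"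
  shows "compression_bound F P m (\<gamma> + \<delta>) \<le> n"
proof (rule compression_bound_le)
  show "1 - (\<gamma> + \<delta>) \<le> P.prob (compression_event F P m n)"
  proof (cases "m \<le> 1")
    \<comment> \<open>The minimum defining the sample complexity starts at \<open>1\<close> and says
      nothing about time \<open>0\<close>. Here \<open>m \<le> n\<close> makes the compression event
      certain.\<close>
    case True
    then have "P.prob (compression_event F P m n) = 1"
      using n(1) by (simp add: compression_event_eq_space P.prob_space)
    then show ?thesis using assms(3,4) by simp
  next
    case False
    then have "enat (m - 1) < enat m" by simp
    then have "enat (m - 1) < sample_complexity F P \<epsilon> (1 - \<gamma>)" using m by (rule order_less_le_trans)
    then have ERM: "P.prob (ERM_good_event F P \<epsilon> (m - 1)) < \<gamma>"
      using prob_ERM_good_event_less False by (fastforce simp: seq_space_def)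
    have "AE \<omega> in S. snd (\<omega> t) = f (fst (\<omega> t))" for t
      using f(2) AE_component[of t "\<lambda>z. snd z = f (fst z)"] by (simp add: realizable_def)
    then have "AE \<omega> in S. \<forall>t. snd (\<omega> t) = f (fst (\<omega> t))"
      by (simp add: AE_all_countable)
    then have "AE \<omega> in S. \<omega> \<in> CAL_good_event X F P \<epsilon> n \<longrightarrow>
        \<omega> \<in> compression_event F P m n \<union> ERM_good_event F P \<epsilon> (m - 1)"
      using AE_space
    proof eventually_elim
      case (elim \<omega>)
      show ?case
      proof (intro impI)
        assume good: "\<omega> \<in> CAL_good_event X F P \<epsilon> n"
        show "\<omega> \<in> compression_event F P m n \<union> ERM_good_event F P \<epsilon> (m - 1)"
        proof (cases "enat m \<le> CAL_time X F n \<omega>")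
          case True
          have "compression_size F (sample (enat m) \<omega>) \<le> num_labels X F m \<omega>"
            by (rule compression_size_le_num_labels[OF f(1)]) (use elim fst_mem_space in auto)
          also have "\<dots> \<le> n" by (rule num_labels_le_if_le_CAL_time[OF n(1) True])
          finally show ?thesis
            using elim by (simp add: compression_event_def seq_space_def)
        next
          case False
          then have "CAL_time X F n \<omega> \<le> enat (m - 1)"
            by (cases "CAL_time X F n \<omega>") auto
          then have "VS F (sample (enat (m - 1)) \<omega>) \<subseteq> VS F (sample (CAL_time X F n \<omega>) \<omega>)"
            by (intro VS_antimono sample_mono)
          then have "sup_er P (VS F (sample (enat (m - 1)) \<omega>)) \<le> \<epsilon>"
            using good order_trans[OF sup_er_mono] by (auto simp: CAL_good_event_def)
          then show ?thesis
            using elim by (simp add: ERM_good_event_def seq_space_def)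
        qed
      qed
    qed
    then have "P.prob (CAL_good_event X F P \<epsilon> n) \<le>
        P.prob (compression_event F P m n \<union> ERM_good_event F P \<epsilon> (m - 1))"
      by (rule P.finite_measure_mono_AE) (intro sets.Un sets_compression_event sets_ERM_good_event)
    also have "\<dots> \<le> P.prob (compression_event F P m n) + P.prob (ERM_good_event F P \<epsilon> (m - 1))"
      by (intro measure_Un_le sets_compression_event sets_ERM_good_event)
    finally show ?thesis using n(2) ERM by simp
  qed
qed (use assms in simp)

section \<open>The upper bound on the label complexity\<close>

text \<open>The first \<open>k\<close> examples and the next \<open>k\<close> are independent
  samples. Each of their version spaces contains that of all \<open>2 * k\<close> examples, so
  failure at time \<open>2 * k\<close> entails failure on both halves.\<close>

lemma prob_not_ERM_good_double_le:
  "P.prob (space S - ERM_good_event F P \<epsilon> (2 * k))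
    \<le> (P.prob (space S - ERM_good_event F P \<epsilon> k))\<^sup>2"
proof -
  let ?B = "\<lambda>m. space S - ERM_good_event F P \<epsilon> m"
  have B: "?B m \<in> sets S" for m using sets_ERM_good_event by auto
  have sub: "(\<lambda>(\<omega>, \<omega>'). comb_seq k \<omega> \<omega>') -` ?B (2 * k) \<inter> space (S \<Otimes>\<^sub>M S) \<subseteq> ?B k \<times> ?B k"
  proof clarsimp
    fix \<omega> \<omega>' assume sp: "(\<omega>, \<omega>') \<in> space (S \<Otimes>\<^sub>M S)" and c: "comb_seq k \<omega> \<omega>' \<in> space S"
      and bad: "comb_seq k \<omega> \<omega>' \<notin> ERM_good_event F P \<epsilon> (2 * k)"
    have in_space: "\<omega> \<in> space S" "\<omega>' \<in> space S" using sp by (auto simp: space_pair_measure)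
    have "\<omega> ` {..<k} \<subseteq> comb_seq k \<omega> \<omega>' ` {..<2 * k}"
    proof
      fix z assume "z \<in> \<omega> ` {..<k}"
      then obtain i where "i < k" "z = \<omega> i" by blast
      then show "z \<in> comb_seq k \<omega> \<omega>' ` {..<2 * k}"
        by (intro image_eqI[of _ _ i]) (auto simp: comb_seq_def)
    qed
    moreover have "\<omega>' ` {..<k} \<subseteq> comb_seq k \<omega> \<omega>' ` {..<2 * k}"
    proof
      fix z assume "z \<in> \<omega>' ` {..<k}"
      then obtain i where "i < k" "z = \<omega>' i" by blast
      then show "z \<in> comb_seq k \<omega> \<omega>' ` {..<2 * k}"
        by (intro image_eqI[of _ _ "k + i"]) (auto simp: comb_seq_def)
    qed
    ultimately have "sup_er P (VS F (comb_seq k \<omega> \<omega>' ` {..<2 * k})) \<le> sup_er P (VS F (\<omega> ` {..<k}))"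
      "sup_er P (VS F (comb_seq k \<omega> \<omega>' ` {..<2 * k})) \<le> sup_er P (VS F (\<omega>' ` {..<k}))"
      by (intro sup_er_mono VS_antimono; simp)+
    then show "\<omega> \<in> space S \<and> \<omega> \<notin> ERM_good_event F P \<epsilon> k \<and> \<omega>' \<in> space S \<and> \<omega>' \<notin> ERM_good_event F P \<epsilon> k"
      using bad c in_space by (auto simp: ERM_good_event_def sample_enat seq_space_def intro: order_trans)
  qed
  have "emeasure S (?B (2 * k)) = emeasure (distr (S \<Otimes>\<^sub>M S) S (\<lambda>(\<omega>, \<omega>'). comb_seq k \<omega> \<omega>')) (?B (2 * k))"
    by (simp only: PiM_comb_seq)
  also have "\<dots> = emeasure (S \<Otimes>\<^sub>M S) ((\<lambda>(\<omega>, \<omega>'). comb_seq k \<omega> \<omega>') -` ?B (2 * k) \<inter> space (S \<Otimes>\<^sub>M S))"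
    by (rule emeasure_distr[OF measurable_comb_seq B])
  also have "\<dots> \<le> emeasure (S \<Otimes>\<^sub>M S) (?B k \<times> ?B k)"
    by (intro emeasure_mono sub pair_measureI B)
  also have "\<dots> = emeasure S (?B k) * emeasure S (?B k)"
    by (intro P.emeasure_pair_measure_Times B)
  finally show ?thesis
    by (simp add: P.emeasure_eq_measure power2_eq_square flip: ennreal_mult)
qed

text \<open>The failure probability splits into \<open>\<delta> / 2\<close> for the compression
  events, \<open>\<delta> / 4\<close> for the deviations at all scales together, and
  \<open>\<delta> / 4\<close> for ERM at time \<open>2 * k\<close>. The real \<open>l\<close> bounds
  the number \<open>L + 1\<close> of scales.\<close>

lemma prob_CAL_good_event_ge:
  fixes d :: "nat \<Rightarrow> real"
  assumes \<delta>: "0 < \<delta>" "\<delta> < 1" and d: "\<And>m. 0 \<le> d m"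
    and k: "1 \<le> k" and L: "2 ^ L \<le> k" "k < 2 ^ (L + 1)"
    and ERM: "1 - \<delta> / 2 \<le> P.prob (ERM_good_event F P \<epsilon> k)"
    and sum_d: "(\<Sum>i\<le>L. d (2 ^ i)) \<le> \<delta> / 2"
    and B: "\<And>m. m \<le> k \<Longrightarrow> real (compression_bound F P m (d m)) *
        ln (exp 1 * real m / real (compression_bound F P m (d m))) \<le> B"
    and l: "real (L + 1) \<le> l"
    and n: "1 + real (L + 1) * (8 * B + 4 * ln (4 * l / \<delta>)) < real n"
  shows "1 - \<delta> \<le> P.prob (CAL_good_event X F P \<epsilon> n)"
proof -
  \<comment> \<open>In \<open>exp (2 * B - \<kappa> / 4)\<close> the part \<open>8 * B\<close>
    cancels \<open>2 * B\<close>, and the rest leaves \<open>\<delta> / (4 * l)\<close> for each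
    scale.\<close>
  define \<kappa> where "\<kappa> = 8 * B + 4 * ln (4 * l / \<delta>)"
  let ?b = "\<lambda>i. compression_bound F P (2 ^ i) (d (2 ^ i))"
  let ?T = "\<lambda>i::nat. {2 ^ i..<2 ^ (i + 2) :: nat}"
  define U where "U i = space S - compression_event F P (2 ^ i) (?b i)" for i
  define W where "W i = compressed_hits (2 ^ i) (?b i) (?T i) \<kappa>" for i
  define V where "V = space S - ERM_good_event F P \<epsilon> (2 * k)"
  have sets: "U i \<in> sets S" "W i \<in> sets S" "V \<in> sets S" for i
    unfolding U_def W_def V_def
    using sets_compression_event sets_ERM_good_event by (auto intro: sets_compressed_hits)
  have b_le: "?b i \<le> 2 ^ i" for i
    by (rule compression_bound_le_size) (rule d)
  have pow_le: "2 ^ i \<le> k" if "i \<le> L" for i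
    using L(1) that power_increasing[of i L "2::nat"] by linarith
  have l_pos: "0 < l" using l by linarith
  have B0: "0 \<le> B"
    using order_trans[OF nonneg_mult_ln_exp_div B[of 0]] compression_bound_le_size[of "d 0" 0] d by simp
  have "1 \<le> 4 * l / \<delta>" using l \<delta> by (simp add: field_simps)
  then have \<kappa>0: "0 \<le> \<kappa>" using B0 by (simp add: \<kappa>_def)
  have "0 \<le> real (L + 1) * \<kappa>" using \<kappa>0 by simp
  then have "1 < real n" using n unfolding \<kappa>_def by linarith
  then have n1: "1 \<le> n" by simp

  have U: "P.prob (U i) \<le> d (2 ^ i)" for i
    using prob_compression_event_bound[OF d, of "2 ^ i" "2 ^ i"]
    by (simp add: U_def P.prob_compl sets_compression_event)
  have W: "P.prob (W i) \<le> \<delta> / (4 * l)" if "i \<le> L" for i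
  proof -
    \<comment> \<open>The block has exactly \<open>3 * 2 ^ i\<close> elements, as many as the size
      condition admits.\<close>
    have "P.prob (W i) \<le> exp (2 * (real (?b i) * ln (exp 1 * real (2 ^ i) / real (?b i))) - \<kappa> / 4)"
      unfolding W_def by (rule prob_compressed_hits_le[OF b_le]) auto
    also have "\<dots> \<le> exp (- ln (4 * l / \<delta>))"
    proof -
      have "2 * x - (8 * B + 4 * y) / 4 \<le> - y" if "x \<le> B" for x y :: real
        using that by (simp add: field_simps)
      then show ?thesis
        unfolding exp_le_cancel_iff \<kappa>_def using B[OF pow_le[OF that]] by blast
    qed
    also have "\<dots> = \<delta> / (4 * l)"
      using l_pos \<delta> by (simp add: exp_minus)
    finally show ?thesis .
  qed
  have V: "P.prob V \<le> \<delta> / 4"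
  proof -
    have "P.prob V \<le> (P.prob (space S - ERM_good_event F P \<epsilon> k))\<^sup>2"
      unfolding V_def by (rule prob_not_ERM_good_double_le)
    also have "\<dots> \<le> (\<delta> / 2)\<^sup>2"
      using ERM by (intro power_mono) (simp_all add: P.prob_compl sets_ERM_good_event)
    also have "\<dots> \<le> \<delta> / 4"
      using \<delta> by (simp add: power2_eq_square)
    finally show ?thesis .
  qed

  have cover: "space S \<subseteq> CAL_good_event X F P \<epsilon> n \<union> (V \<union> ((\<Union>i\<le>L. U i) \<union> (\<Union>i\<le>L. W i)))"
  proof
    fix \<omega> assume \<omega>: "\<omega> \<in> space S"
    show "\<omega> \<in> CAL_good_event X F P \<epsilon> n \<union> (V \<union> ((\<Union>i\<le>L. U i) \<union> (\<Union>i\<le>L. W i)))"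
    proof (rule ccontr)
      assume "\<not> ?thesis"
      then have not_good: "\<omega> \<notin> CAL_good_event X F P \<epsilon> n" and V: "\<omega> \<notin> V"
        and U: "\<And>i. i \<le> L \<Longrightarrow> \<omega> \<notin> U i" and W: "\<And>i. i \<le> L \<Longrightarrow> \<omega> \<notin> W i" by auto
      \<comment> \<open>Requests in a block are compared with the version space at its start, which
        contains all later ones.\<close>
      let ?H = "\<lambda>i. {t \<in> ?T i. fst (\<omega> t) \<in> DIS X (VS F (\<omega> ` {..<2 ^ i}))}"
      have hits: "real (card (?H i)) \<le> \<kappa>" if i: "i \<le> L" for i
      proof -
        have "compression_size F (sample (enat (2 ^ i)) \<omega>) \<le> ?b i"
          using U[OF i] \<omega> by (auto simp: U_def compression_event_def seq_space_def)
        then obtain I where I: "I \<subseteq> {..<2 ^ i}" "card I = ?b i"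
            "VS F (\<omega> ` I) = VS F (\<omega> ` {..<2 ^ i})"
          using compression_index_set b_le by blast
        have "\<forall>t\<in>{..<2 ^ i} - I. fst (\<omega> t) \<notin> DIS X (VS F (\<omega> ` I))"
          unfolding I(3) by (auto intro!: sample_notin_DIS)
        then show ?thesis
          using W[OF i] \<omega> I by (auto simp: W_def compressed_hits_def)
      qed
      \<comment> \<open>Time \<open>0\<close> lies in no block; it accounts for the summand
        \<open>1\<close> in the hypothesis on \<open>n\<close>.\<close>
      have "{t \<in> {..<2 * k}. fst (\<omega> t) \<in> DIS X (VS F (\<omega> ` {..<t}))} \<subseteq> {0} \<union> (\<Union>i\<le>L. ?H i)"
      proof clarify
        fix t assume t: "t < 2 * k" and q: "fst (\<omega> t) \<in> DIS X (VS F (\<omega> ` {..<t}))"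
          and *: "t \<notin> (\<Union>i\<le>L. ?H i)"
        show "t = 0"
        proof (rule ccontr)
          assume "t \<noteq> 0"
          then obtain i where i: "i \<le> L" "t \<in> ?T i"
            using dyadic_cover[OF L] t by blast
          then have "\<omega> ` {..<2 ^ i} \<subseteq> \<omega> ` {..<t}" by auto
          then have "DIS X (VS F (\<omega> ` {..<t})) \<subseteq> DIS X (VS F (\<omega> ` {..<2 ^ i}))"
            by (intro DIS_mono VS_antimono)
          then show False using * i q by blast
        qed
      qed
      then have "num_labels X F (2 * k) \<omega> \<le> card ({0} \<union> (\<Union>i\<le>L. ?H i))"
        unfolding num_labels_eq_card by (intro card_mono) auto
      also have "\<dots> \<le> 1 + card (\<Union>i\<le>L. ?H i)"
        using card_Un_le[of "{0::nat}"] by simp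
      also have "card (\<Union>i\<le>L. ?H i) \<le> (\<Sum>i\<le>L. card (?H i))"
        by (rule card_UN_le) simp
      finally have "real (num_labels X F (2 * k) \<omega>) \<le> 1 + (\<Sum>i\<le>L. real (card (?H i)))"
        unfolding of_nat_sum[symmetric] by linarith
      also have "(\<Sum>i\<le>L. real (card (?H i))) \<le> (\<Sum>i\<le>L. \<kappa>)"
        by (intro sum_mono hits) simp
      also have "\<dots> = real (L + 1) * \<kappa>" by simp
      finally have "num_labels X F (2 * k) \<omega> < n"
        using n by (simp add: \<kappa>_def)
      \<comment> \<open>Whether the budget is exhausted later or never, the final version space lies
        inside that of the first \<open>2 * k\<close> examples.\<close>
      then have "enat (2 * k) \<le> CAL_time X F n \<omega>"
        by (rule le_CAL_time_if_num_labels_less)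
      then have "sup_er P (VS F (sample (CAL_time X F n \<omega>) \<omega>)) \<le> sup_er P (VS F (sample (enat (2 * k)) \<omega>))"
        by (intro sup_er_mono VS_antimono sample_mono)
      also have "\<dots> \<le> \<epsilon>" using V \<omega> by (auto simp: V_def ERM_good_event_def)
      finally show False using not_good \<omega> by (simp add: CAL_good_event_def seq_space_def)
    qed
  qed
  have "1 \<le> P.prob (CAL_good_event X F P \<epsilon> n \<union> (V \<union> ((\<Union>i\<le>L. U i) \<union> (\<Union>i\<le>L. W i))))"
    using P.finite_measure_mono[OF cover] sets sets_CAL_good_event[OF n1]
    by (simp add: P.prob_space sets.Un sets.finite_UN)
  also have "\<dots> \<le> P.prob (CAL_good_event X F P \<epsilon> n) + (P.prob V +
      (P.prob (\<Union>i\<le>L. U i) + P.prob (\<Union>i\<le>L. W i)))"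
    using sets sets_CAL_good_event[OF n1]
    by (intro order_trans[OF measure_Un_le] add_left_mono sets.Un sets.finite_UN) auto
  also have "P.prob (\<Union>i\<le>L. U i) \<le> (\<Sum>i\<le>L. P.prob (U i))"
    using sets by (intro P.finite_measure_subadditive_finite) auto
  also have "\<dots> \<le> (\<Sum>i\<le>L. d (2 ^ i))" by (intro sum_mono U)
  also have "P.prob (\<Union>i\<le>L. W i) \<le> (\<Sum>i\<le>L. P.prob (W i))"
    using sets by (intro P.finite_measure_subadditive_finite) auto
  also have "\<dots> \<le> (\<Sum>i\<le>L. \<delta> / (4 * l))" by (intro sum_mono W) simp
  also have "\<dots> = real (L + 1) * (\<delta> / (4 * l))" by simp
  also have "\<dots> \<le> l * (\<delta> / (4 * l))"
    using l l_pos \<delta> by (intro mult_right_mono) auto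
  also have "\<dots> = \<delta> / 4" using l_pos by simp
  finally show ?thesis using V sum_d by simp
qed

text \<open>The least integer above \<open>1 + l * \<kappa>\<close> serves as the budget. Additive
  constants are absorbed into a multiple of \<open>B + ln (l / \<delta>)\<close>, which the last
  hypothesis keeps above a positive constant.\<close>

lemma label_complexity_le:
  assumes \<delta>: "0 < \<delta>" "\<delta> < 1" and d: "\<And>m. 0 \<le> d m"
    and dyadic: "dyadic_sum (sample_complexity F P \<epsilon> (\<delta> / 2)) d \<le> ennreal (\<delta> / 2)"
    and nontrivial: "\<delta> \<le> 1 / 2 \<or> (\<exists>h\<in>F. er P h > \<epsilon>)"
  shows "ereal_of_enat (label_complexity X F P \<epsilon> \<delta>)
    \<le> CAL_upper_bound 28 F P (sample_complexity F P \<epsilon> (\<delta> / 2)) \<delta> d"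
proof (cases "sample_complexity F P \<epsilon> (\<delta> / 2)")
  case (enat k)
  let ?A = "{enat m | m. m \<ge> 1 \<and> measure (seq_space P) (ERM_good_event F P \<epsilon> m) \<ge> 1 - \<delta> / 2}"
  have "?A \<noteq> {}"
  proof
    assume "?A = {}"
    with enat show False
      unfolding sample_complexity_def by (simp only: Inf_empty) (simp add: top_enat_def)
  qed
  then obtain x where "x \<in> ?A" by (auto simp only: ex_in_conv[symmetric])
  then have "Inf ?A \<in> ?A" by (rule wellorder_InfI)
  then have "enat k \<in> ?A"
    using enat unfolding sample_complexity_def by (simp only:)
  then have k: "1 \<le> k" and ERM: "1 - \<delta> / 2 \<le> P.prob (ERM_good_event F P \<epsilon> k)"
    by (auto simp: seq_space_def)
  define L where "L = nat \<lfloor>log 2 (real k)\<rfloor>"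
  define l where "l = log 2 (2 * real k)"
  note L = nat_floor_log2[OF k, folded L_def l_def]
  have l1: "1 \<le> l" using L(3) by linarith
  have "ennreal (\<Sum>i\<le>L. d (2 ^ i)) \<le> ennreal (\<delta> / 2)"
    using dyadic d by (simp add: enat dyadic_sum_def L_def sum_ennreal atLeast0AtMost)
  then have sum_d: "(\<Sum>i\<le>L. d (2 ^ i)) \<le> \<delta> / 2"
    using \<delta> by simp
  let ?B = "\<lambda>m. real (compression_bound F P m (d m)) *
      ln (exp 1 * real m / real (compression_bound F P m (d m)))"
  define B where "B = (MAX m\<in>{0..k}. ?B m)"
  have B: "?B m \<le> B" if "m \<le> k" for m
    unfolding B_def using that by (intro Max_ge) auto
  have B0: "0 \<le> B"
    using order_trans[OF nonneg_mult_ln_exp_div B[of 0]] compression_bound_le_size[of "d 0" 0] d by simp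
  define \<kappa> where "\<kappa> = 8 * B + 4 * ln (4 * l / \<delta>)"
  have "1 \<le> 4 * l / \<delta>" using l1 \<delta> by (simp add: field_simps)
  then have \<kappa>0: "0 \<le> \<kappa>" using B0 by (simp add: \<kappa>_def)
  define n where "n = nat \<lfloor>1 + l * \<kappa>\<rfloor> + 1"
  have lk: "0 \<le> l * \<kappa>" using l1 \<kappa>0 by simp
  have n: "1 + l * \<kappa> < real n" "real n \<le> 2 + l * \<kappa>"
    using lk unfolding n_def by linarith+
  have "real (L + 1) * \<kappa> \<le> l * \<kappa>" using L(3) \<kappa>0 by (rule mult_right_mono)
  then have "1 - \<delta> \<le> P.prob (CAL_good_event X F P \<epsilon> n)"
    using n(1) by (intro prob_CAL_good_event_ge[OF \<delta> d k L(1,2) ERM sum_d B L(3)]) (auto simp: \<kappa>_def)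
  then have "label_complexity X F P \<epsilon> \<delta> \<le> enat n"
    unfolding label_complexity_def by (intro Inf_lower) (auto simp: seq_space_def n_def)
  then have "ereal_of_enat (label_complexity X F P \<epsilon> \<delta>) \<le> ereal_of_enat (enat n)"
    by (simp only: ereal_of_enat_le_iff)
  also have "\<dots> = ereal (real n)" by simp
  also have "\<dots> \<le> ereal (28 * (B + ln (l / \<delta>)) * l)"
  proof -
    have ln2: "1 / 2 \<le> ln (2::real)" 
      using ln_le_minus_one[of "1 / 2 :: real"] by (simp add: ln_div)
    have ld: "1 \<le> l / \<delta>" using l1 \<delta> by (simp add: field_simps)
    \<comment> \<open>If \<open>l < 2 * \<delta>\<close>, then \<open>k = 1\<close> and
      \<open>\<delta> > 1 / 2\<close>, so some \<open>h\<close> in \<open>F\<close> has error above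
      \<open>\<epsilon>\<close>. It forces the compression bound \<open>1\<close> at
      \<open>m = 1\<close>, whence \<open>B \<ge> ln (exp 1) = 1\<close>.\<close>
    have Q: "1 / 2 \<le> B + ln (l / \<delta>)"
    proof (cases "2 \<le> l / \<delta>")
      case True
      then have "ln 2 \<le> ln (l / \<delta>)" by simp
      then show ?thesis using ln2 B0 by linarith
    next
      case False
      then have small: "l < 2 * \<delta>" using \<delta> by (simp add: field_simps)
      then have "\<not> \<delta> \<le> 1 / 2" using l1 by linarith
      then obtain h where h: "h \<in> F" "er P h > \<epsilon>" using nontrivial by blast
      have "l = 1 + log 2 (real k)" using k by (simp add: l_def log_mult)
      then have "log 2 (real k) < 1" using small \<delta> by linarith
      then have "real k < 2" using k by (simp add: log_less_iff)
      then have k1: "k = 1" using k by simp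
      \<comment> \<open>An empty compression set would keep \<open>h\<close> in the version space,
        making the compression event disjoint from the good event of ERM. But each would have
        probability at least \<open>1 - \<delta> / 2 > 1 / 2\<close>.\<close>
      have "compression_bound F P 1 (d 1) \<noteq> 0"
      proof
        assume 0: "compression_bound F P 1 (d 1) = 0"
        have "compression_event F P 1 0 \<inter> ERM_good_event F P \<epsilon> 1 = {}"
        proof safe
          fix \<omega> assume c: "\<omega> \<in> compression_event F P 1 0" and e: "\<omega> \<in> ERM_good_event F P \<epsilon> 1"
          have "compression_size F (sample (enat 1) \<omega>) = 0"
            using c by (simp add: compression_event_def)
          then obtain C where "C \<subseteq> sample (enat 1) \<omega>" "card C = 0" "VS F C = VS F (sample (enat 1) \<omega>)"
            using compression_size_witness by metis
          \<comment> \<open>Cardinality \<open>0\<close> means empty here because \<open>C\<close>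
            lies in a finite sample.\<close>
          then have "VS F (sample (enat 1) \<omega>) = VS F {}"
            by (metis card_0_eq finite_imageI finite_lessThan finite_subset sample_enat)
          then have "h \<in> VS F (sample (enat 1) \<omega>)" using h by (simp add: mem_VS_iff)
          then have "ereal (er P h) \<le> sup_er P (VS F (sample (enat 1) \<omega>))"
            unfolding sup_er_def by (rule SUP_upper)
          also have "\<dots> \<le> \<epsilon>" using e by (simp add: ERM_good_event_def)
          finally show "\<omega> \<in> {}" using h by simp
        qed
        then have "P.prob (compression_event F P 1 0) + P.prob (ERM_good_event F P \<epsilon> 1) \<le> 1"
          using P.prob_le_1 P.finite_measure_Union[OF sets_compression_event sets_ERM_good_event]
          by metis
        moreover have "1 - d 1 \<le> P.prob (compression_event F P 1 0)"
          using prob_compression_event_bound[OF d, of 1 1] by (simp only: 0)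
        moreover have "d 1 \<le> (\<Sum>i\<le>L. d (2 ^ i))"
          using member_le_sum[of 0 "{..L}" "\<lambda>i. d (2 ^ i)"] d by simp
        ultimately show False using ERM sum_d \<delta> by (simp add: k1)
      qed
      then have "compression_bound F P 1 (d 1) = 1"
        using compression_bound_le_size[OF d, of 1 1] by simp
      then have "1 \<le> B" using B[of 1] k1 by simp
      then show ?thesis using ln_ge_zero[OF ld] by linarith
    qed
    have ln4: "ln (4 * l / \<delta>) \<le> 2 + ln (l / \<delta>)"
    proof -
      have "ln (2 * (2 * r)) = ln 2 + (ln 2 + ln r)" if "1 \<le> r" for r :: real
      proof -
        have "ln (2 * (2 * r)) = ln 2 + ln (2 * r)" "ln (2 * r) = ln 2 + ln r"
          by (rule ln_mult_pos; use that in linarith)+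
        then show ?thesis by (simp only:)
      qed
      from this[OF ld] have "ln (2 * (2 * (l / \<delta>))) = ln 2 + (ln 2 + ln (l / \<delta>))" .
      moreover have "2 * (2 * (l / \<delta>)) = 4 * l / \<delta>" by simp
      moreover have "ln 2 \<le> (1::real)" using ln_le_minus_one[of "2::real"] by simp
      ultimately show ?thesis by simp
    qed
    have "2 \<le> l * 2" using l1 by simp
    then have "2 + l * \<kappa> \<le> l * (2 + \<kappa>)" by (simp add: algebra_simps)
    also have "\<dots> \<le> l * (28 * (B + ln (l / \<delta>)))"
    proof (rule mult_left_mono)
      \<comment> \<open>The left side is at most \<open>10 + 8 * B + 4 * y\<close>, and
        \<open>10 \<le> 20 * (B + y)\<close>; this gives the constant \<open>28\<close>.\<close>
      have "2 + (8 * B + 4 * x) \<le> 28 * (B + y)"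
        if "x \<le> 2 + y" "1 / 2 \<le> B + y" "0 \<le> y" for x y :: real
        using that B0 by argo
      then show "2 + \<kappa> \<le> 28 * (B + ln (l / \<delta>))"
        unfolding \<kappa>_def using ln4 Q ln_ge_zero[OF ld] by blast
    qed (use l1 in simp)
    finally show ?thesis using n(2) by (simp add: mult_ac)
  qed
  also have "\<dots> = CAL_upper_bound 28 F P (sample_complexity F P \<epsilon> (\<delta> / 2)) \<delta> d"
    by (simp add: CAL_upper_bound_def enat B_def l_def)
  finally show ?thesis .
qed (simp add: CAL_upper_bound_def)

text \<open>Bounding a supremum by an infimum amounts to comparing every \<open>m\<close> with every
  admissible budget \<open>n\<close>, which also covers infinite values.\<close>

lemma SUP_compression_bound_le:
  assumes f: "f \<in> F" "realizable P f" and "0 \<le> \<gamma>" "0 \<le> \<delta>"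
  shows "(SUP m\<in>{m. enat m \<le> sample_complexity F P \<epsilon> (1 - \<gamma>)}.
    enat (compression_bound F P m (\<gamma> + \<delta>))) \<le> label_complexity X F P \<epsilon> \<delta>"
  unfolding label_complexity_def
  using compression_bound_le_budget[OF assms]
  by (intro SUP_least Inf_greatest) (auto simp: seq_space_def)

end

theorem theorem9:
  shows "\<exists>c>0. \<forall>(X :: 'x measure) F P f (\<epsilon>::real) (\<delta>::real) (\<beta>::real) (d :: nat \<Rightarrow> real).
    prob_space P \<longrightarrow>
    sets P = sets (X \<Otimes>\<^sub>M label_space) \<longrightarrow>
    F \<subseteq> classifiers X \<longrightarrow>
    f \<in> F \<longrightarrow>
    realizable P f \<longrightarrow>
    measurable_events X F P \<epsilon> \<longrightarrow>
    0 < \<epsilon> \<longrightarrow> \<epsilon> < 1 \<longrightarrow>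
    0 < \<delta> \<longrightarrow> \<delta> < 1 \<longrightarrow>
    0 < \<beta> \<longrightarrow> \<beta> < (1 - \<delta>) / \<delta> \<longrightarrow>
    (\<forall>m. 0 < d m \<and> d m \<le> 1) \<longrightarrow>
    dyadic_sum (sample_complexity F P \<epsilon> (\<delta> / 2)) d \<le> ennreal (\<delta> / 2) \<longrightarrow>
      (SUP m\<in>{m. enat m \<le> sample_complexity F P \<epsilon> (1 - \<beta> * \<delta>)}.
          enat (compression_bound F P m ((1 + \<beta>) * \<delta>))) \<le> label_complexity X F P \<epsilon> \<delta>
      \<and> (\<delta> \<le> 1 / 2 \<or> (\<exists>h\<in>F. er P h > \<epsilon>) \<longrightarrow>
          ereal_of_enat (label_complexity X F P \<epsilon> \<delta>)
            \<le> CAL_upper_bound c F P (sample_complexity F P \<epsilon> (\<delta> / 2)) \<delta> d)"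
proof (intro exI[of _ 28] conjI allI impI)
  fix X :: "'x measure" and F P f and \<epsilon> \<delta> \<beta> :: real and d :: "nat \<Rightarrow> real"
  assume P: "prob_space P" "sets P = sets (X \<Otimes>\<^sub>M label_space)" "measurable_events X F P \<epsilon>"
    and f: "f \<in> F" "realizable P f" and \<delta>: "0 < \<delta>" "\<delta> < 1" and \<beta>: "0 < \<beta>"
    and d: "\<forall>m. 0 < d m \<and> d m \<le> 1"
    and dyadic: "dyadic_sum (sample_complexity F P \<epsilon> (\<delta> / 2)) d \<le> ennreal (\<delta> / 2)"
  interpret active_learning X F P \<epsilon>
    by (rule active_learning.intro) (fact P)+
  show "(SUP m\<in>{m. enat m \<le> sample_complexity F P \<epsilon> (1 - \<beta> * \<delta>)}.
      enat (compression_bound F P m ((1 + \<beta>) * \<delta>))) \<le> label_complexity X F P \<epsilon> \<delta>"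
    \<comment> \<open>With \<open>\<gamma> = \<beta> * \<delta>\<close> the two failure
      probabilities add up to \<open>(1 + \<beta>) * \<delta>\<close>.\<close>
    using SUP_compression_bound_le[OF f, of "\<beta> * \<delta>" \<delta>] \<delta> \<beta> by (simp add: algebra_simps)
  show "ereal_of_enat (label_complexity X F P \<epsilon> \<delta>)
      \<le> CAL_upper_bound 28 F P (sample_complexity F P \<epsilon> (\<delta> / 2)) \<delta> d"
    if "\<delta> \<le> 1 / 2 \<or> (\<exists>h\<in>F. er P h > \<epsilon>)"
    using label_complexity_le[OF \<delta> _ dyadic that] d by (simp add: less_imp_le)
qed simp

end
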